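(* Let $X$ be a finite set of alternatives with $|X|=m\geq 3$ and let $N=\{1,\dots,n\}$ with $n\geq 2$. Let $G_C$ be the Copeland rule on $L(X)^N$, and let $S\subseteq X$ with $|S|=k$, $1\leq k\leq m$. (1) If $n$ is even, then there is a profile $u\in L(X)^N$ with $G_C(u)=S$. (2) If $n$ is odd and $m$ is even, then there is a profile $u\in L(X)^N$ with $G_C(u)=S$ if and only if $k\neq m$. (3) If $n$ is odd and $m$ is odd, then there is a profile $u\in L(X)^N$ with $G_C(u)=S$ if and only if $k\neq m-1$.
   Context: $L(X)$ is the set of strong orderings on $X$: complete (any two distinct alternatives are comparable), asymmetric, transitive relations. A profile is $u=(u(1),\dots,u(n))\in L(X)^N$; $x\succ_{u(i)}y$ means $x$ ranks above $y$ in $u(i)$. Alternative $x$ defeats $y$ under simple majority vote at $u$ if $|\{i: x\succ_{u(i)}y\}|>|\{i: y\succ_{u(i)}x\}|$. The Copeland score $n_x(u)$ is the number of alternatives defeated by $x$ under simple majority vote at $u$. The Copeland rule is $G_C(u)=\{x\in X: n_x(u)\geq n_z(u)\text{ for all }z\in X\}$. *)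

theory Defs
  imports Main "HOL-Library.FuncSet"
begin

text \<open>
  A relation \<open>r\<close> is read as \<open>(x, y) \<in> r\<close> iff \<open>x\<close> ranks above \<open>y\<close>.  The inclusion
  \<open>r \<subseteq> X \<times> X\<close> makes \<open>r\<close> a relation on \<open>X\<close>; \<open>total_on\<close> only compares distinct elements.
\<close>

definition strong_orderings :: "'a set \<Rightarrow> 'a rel set" where
  "strong_orderings X = {r. r \<subseteq> X \<times> X \<and> total_on X r \<and> asym r \<and> trans r}"

definition profiles :: "'a set \<Rightarrow> nat \<Rightarrow> (nat \<Rightarrow> 'a rel) set" where
  "profiles X n = {1..n} \<rightarrow>\<^sub>E strong_orderings X"

definition defeats :: "nat \<Rightarrow> (nat \<Rightarrow> 'a rel) \<Rightarrow> 'a \<Rightarrow> 'a \<Rightarrow> bool" where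
  "defeats n u x y \<longleftrightarrow> card {i \<in> {1..n}. (x, y) \<in> u i} > card {i \<in> {1..n}. (y, x) \<in> u i}"

definition copeland_score :: "'a set \<Rightarrow> nat \<Rightarrow> (nat \<Rightarrow> 'a rel) \<Rightarrow> 'a \<Rightarrow> nat" where
  "copeland_score X n u x = card {y \<in> X. defeats n u x y}"

definition copeland_rule :: "'a set \<Rightarrow> nat \<Rightarrow> (nat \<Rightarrow> 'a rel) \<Rightarrow> 'a set" where
  "copeland_rule X n u =
     {x \<in> X. \<forall>z \<in> X. copeland_score X n u x \<ge> copeland_score X n u z}"

end

theory Submission
  imports Defs
begin

text \<open>
  The construction starts from a small electorate and a small set of alternatives and enlarges
  both.  Two voters with opposite preferences cancel, so adding such a pair changes no majority
  (\<open>elects_add_voters\<close>); and an alternative that every voter ranks last raises the score of all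
  others by one and itself scores zero (\<open>elects_add_alternative\<close>).  It is therefore enough to
  choose \<open>S\<close> with two voters (\<open>n\<close> even) or three voters (\<open>n\<close> odd) from some set between \<open>S\<close>
  and \<open>X\<close>.

  With two opposite voters nobody defeats anybody, so all of \<open>S\<close> is chosen from \<open>S\<close>.

  With three voters and \<open>|S| = 2q + 1\<close>, the majority relation can be made the rotational
  tournament on \<open>S\<close>, in which \<open>i\<close> defeats the \<open>q\<close> alternatives following it cyclically; all
  scores are \<open>q\<close>.  If \<open>|S| = 2q\<close> with \<open>q \<ge> 1\<close>, two further alternatives \<open>a\<close> and \<open>b\<close> are used:
  \<open>S\<close> together with \<open>a\<close> forms the rotational tournament, all of \<open>S\<close> defeats \<open>b\<close>, and \<open>b\<close>
  defeats \<open>a\<close>.  The scores are then \<open>q + 1\<close> on \<open>S\<close>, \<open>q\<close> at \<open>a\<close> and \<open>1\<close> at \<open>b\<close>.  So for odd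
  \<open>n\<close> every odd \<open>k\<close> and every even \<open>k \<le> m - 2\<close> is attained.

  Conversely, for odd \<open>n\<close> there are no ties, and the scores add up to \<open>m (m - 1) / 2\<close>
  (\<open>sum_copeland_scores\<close>).  If all \<open>m\<close> scores are equal, they equal \<open>(m - 1) / 2\<close>, which
  forces \<open>m\<close> to be odd.  If \<open>m = 2p + 1\<close> and all scores but one equal \<open>s\<close> while the last one is
  \<open>t < s\<close>, then \<open>t + 2ps = 2p\<^sup>2 + p\<close>: for \<open>s \<le> p\<close> this gives \<open>t \<ge> p \<ge> s\<close>, and for
  \<open>s > p\<close> the left side is too large.
\<close>

section \<open>Profiles and majorities\<close>

definition elects :: "'a set \<Rightarrow> nat \<Rightarrow> 'a set \<Rightarrow> bool" where
  "elects X n S \<longleftrightarrow> (\<exists>u \<in> profiles X n. copeland_rule X n u = S)"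

lemma defeats_iff_sum:
  "defeats n u x y \<longleftrightarrow>
     (\<Sum>i=1..n. of_bool ((y, x) \<in> u i)) < (\<Sum>i=1..n. of_bool ((x, y) \<in> u i) :: nat)"
proof -
  have "card {i \<in> {1..n}. P i} = (\<Sum>i=1..n. of_bool (P i))" for P
    by (simp add: of_bool_def sum.If_cases Int_def conj_commute)
  then show ?thesis by (simp add: defeats_def)
qed

lemma profilesI:
  "(\<And>i. i \<in> {1..n} \<Longrightarrow> u i \<in> strong_orderings X) \<Longrightarrow> (\<And>i. i \<notin> {1..n} \<Longrightarrow> u i = undefined)
    \<Longrightarrow> u \<in> profiles X n"
  unfolding profiles_def by (rule PiE_I)

lemma profilesD: "u \<in> profiles X n \<Longrightarrow> i \<in> {1..n} \<Longrightarrow> u i \<in> strong_orderings X"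
  unfolding profiles_def by (rule PiE_mem)

lemma strong_orderings_converse: "R \<in> strong_orderings X \<Longrightarrow> R\<inverse> \<in> strong_orderings X"
  unfolding strong_orderings_def
  by (auto simp: total_on_def asym_iff intro!: transI dest: transD)

lemma strong_orderings_key:
  fixes f :: "'a \<Rightarrow> int"
  assumes "inj_on f X"
  shows "{(x, y). x \<in> X \<and> y \<in> X \<and> f x < f y} \<in> strong_orderings X"
  using assms unfolding strong_orderings_def
  by (auto simp: total_on_def asym_iff inj_on_def intro!: transI) (metis linorder_neqE)

section \<open>Adding voters and alternatives\<close>

text \<open>A voter and its mirror image together contribute the same amount to both sides of every
  pairwise comparison.  The mirror image of an arbitrary voter of the given profile serves.\<close>

lemma elects_add_voters:
  assumes "elects X n S" and "n \<ge> 1"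
  shows "elects X (n + 2) S"
proof -
  obtain u where u: "u \<in> profiles X n" "copeland_rule X n u = S"
    using assms(1) unfolding elects_def by blast
  define v where "v = u(Suc n := u 1, Suc (Suc n) := (u 1)\<inverse>)"
  have u1: "u 1 \<in> strong_orderings X" using u(1) assms(2) by (intro profilesD) auto
  have "v i \<in> strong_orderings X" if i: "i \<in> {1..n + 2}" for i
  proof -
    consider "i \<in> {1..n}" | "i = Suc n" | "i = Suc (Suc n)" using i by fastforce
    then show ?thesis
      by cases (use u1 in \<open>auto simp: v_def strong_orderings_converse intro: profilesD[OF u(1)]\<close>)
  qed
  moreover have "v i = undefined" if "i \<notin> {1..n + 2}" for i
  proof -
    have "i \<notin> {1..n}" "i \<noteq> Suc n" "i \<noteq> Suc (Suc n)" using that by auto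
    with u(1) show ?thesis unfolding profiles_def v_def by (auto intro: PiE_arb)
  qed
  ultimately have v: "v \<in> profiles X (n + 2)" by (rule profilesI)
  have count: "(\<Sum>i=1..n + 2. of_bool ((x, y) \<in> v i)) =
      (\<Sum>i=1..n. of_bool ((x, y) \<in> u i)) + of_bool ((x, y) \<in> u 1) + (of_bool ((y, x) \<in> u 1) :: nat)"
    for x y
  proof -
    have "(\<Sum>i=1..n. of_bool ((x, y) \<in> v i)) = (\<Sum>i=1..n. of_bool ((x, y) \<in> u i) :: nat)"
      by (rule sum.cong) (auto simp: v_def)
    then show ?thesis by (simp add: v_def)
  qed
  have "defeats (n + 2) v = defeats n u"
    by (intro ext) (simp only: defeats_iff_sum count, simp)
  then have "copeland_rule X (n + 2) v = S"
    using u(2) by (simp add: copeland_rule_def copeland_score_def)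
  with v show ?thesis unfolding elects_def by blast
qed

lemma elects_add_voter_pairs:
  "elects X n S \<Longrightarrow> n \<ge> 1 \<Longrightarrow> elects X (n + 2 * p) S"
proof (induction p)
  case (Suc p)
  then show ?case using elects_add_voters[of X "n + 2 * p" S] by simp
qed simp

text \<open>The new alternative is put at the bottom of every preference.  It is defeated by all of \<open>Y\<close>,
  which shifts all scores on \<open>Y\<close> by one and keeps the newcomer, with score zero, out of the
  choice.\<close>

lemma elects_add_alternative:
  assumes "elects Y n S" and "finite Y" "Y \<noteq> {}" "x \<notin> Y" "n \<ge> 1"
  shows "elects (insert x Y) n S"
proof -
  obtain u where u: "u \<in> profiles Y n" "copeland_rule Y n u = S"
    using assms(1) unfolding elects_def by blast
  define v where "v = restrict (\<lambda>i. u i \<union> Y \<times> {x}) {1..n}"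
  have "u i \<union> Y \<times> {x} \<in> strong_orderings (insert x Y)" if "i \<in> {1..n}" for i
    using profilesD[OF u(1) that] \<open>x \<notin> Y\<close> unfolding strong_orderings_def
    by (auto simp: total_on_def asym_iff intro!: transI dest: transD)
  then have v: "v \<in> profiles (insert x Y) n"
    by (intro profilesI) (auto simp: v_def)
  have sub: "u i \<subseteq> Y \<times> Y" if "i \<in> {1..n}" for i
    using profilesD[OF u(1) that] unfolding strong_orderings_def by auto
  have old: "defeats n v y z \<longleftrightarrow> defeats n u y z" if "y \<in> Y" "z \<in> Y" for y z
  proof -
    have "(y, z) \<in> v i \<longleftrightarrow> (y, z) \<in> u i" "(z, y) \<in> v i \<longleftrightarrow> (z, y) \<in> u i" if "i \<in> {1..n}" for i
      using that \<open>y \<in> Y\<close> \<open>z \<in> Y\<close> \<open>x \<notin> Y\<close> by (auto simp: v_def)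
    then show ?thesis unfolding defeats_def by (metis (mono_tags, lifting) Collect_cong)
  qed
  have above: "(y, x) \<in> v i" "(x, y) \<notin> v i" if "y \<in> Y" "i \<in> {1..n}" for y i
    using that sub[OF that(2)] \<open>x \<notin> Y\<close> by (auto simp: v_def)
  have new: "defeats n v y x" "\<not> defeats n v x y" if "y \<in> Y" for y
  proof -
    have "{i \<in> {1..n}. (y, x) \<in> v i} = {1..n}" "{i \<in> {1..n}. (x, y) \<in> v i} = {}"
      using above that by auto
    then show "defeats n v y x" "\<not> defeats n v x y"
      using \<open>n \<ge> 1\<close> by (simp_all only: defeats_def card.empty card_atLeastAtMost)
  qed
  have score: "copeland_score (insert x Y) n v y = Suc (copeland_score Y n u y)" if "y \<in> Y" for y
  proof -
    have "{z \<in> insert x Y. defeats n v y z} = insert x {z \<in> Y. defeats n u y z}"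
      using that old new by auto
    then show ?thesis using \<open>finite Y\<close> \<open>x \<notin> Y\<close> by (simp add: copeland_score_def)
  qed
  have "{z \<in> insert x Y. defeats n v x z} = {}"
    using new by (auto simp: defeats_def)
  then have "copeland_score (insert x Y) n v x = 0"
    by (simp only: copeland_score_def card.empty)
  with score \<open>Y \<noteq> {}\<close> \<open>x \<notin> Y\<close>
  have "copeland_rule (insert x Y) n v = copeland_rule Y n u"
    by (auto simp: copeland_rule_def)
  with v u(2) show ?thesis unfolding elects_def by blast
qed

lemma elects_superset:
  assumes "elects Y n S" and "Y \<subseteq> X" "finite X" "Y \<noteq> {}" "n \<ge> 1"
  shows "elects X n S"
proof -
  have "finite Y" using assms finite_subset by blast
  have "elects (Y \<union> F) n S" if "finite F" "F \<inter> Y = {}" for F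
    using that
  proof (induction F)
    case empty
    then show ?case using assms(1) by simp
  next
    case (insert x F)
    then show ?case
      using elects_add_alternative[of "Y \<union> F" n S x] \<open>finite Y\<close> \<open>Y \<noteq> {}\<close> \<open>n \<ge> 1\<close> by auto
  qed
  from this[of "X - Y"] have "elects (Y \<union> (X - Y)) n S" using \<open>finite X\<close> by blast
  then show ?thesis using \<open>Y \<subseteq> X\<close> by (simp add: Un_absorb1)
qed

section \<open>Two voters\<close>

lemma elects_two_all:
  assumes "finite X"
  shows "elects X 2 X"
proof -
  obtain e :: "'a \<Rightarrow> nat" where "inj_on e X"
    using finite_imp_inj_to_nat_seg[OF assms] by blast
  then have R: "{(x, y). x \<in> X \<and> y \<in> X \<and> int (e x) < int (e y)} \<in> strong_orderings X" (is "?R \<in> _")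
    by (intro strong_orderings_key) (auto simp: inj_on_def)
  define u where "u = restrict (\<lambda>i. if i = 1 then ?R else ?R\<inverse>) {1..2::nat}"
  have u: "u \<in> profiles X 2"
    using R strong_orderings_converse[OF R] by (intro profilesI) (auto simp: u_def)
  have "\<not> defeats 2 u x y" for x y
    by (simp add: defeats_iff_sum u_def numeral_2_eq_2)
  then have "copeland_rule X 2 u = X"
    by (simp add: copeland_rule_def copeland_score_def)
  with u show ?thesis unfolding elects_def by blast
qed

section \<open>Three voters\<close>

definition majority3 :: "('b \<Rightarrow> int) \<Rightarrow> ('b \<Rightarrow> int) \<Rightarrow> ('b \<Rightarrow> int) \<Rightarrow> 'b \<Rightarrow> 'b \<Rightarrow> bool" where
  "majority3 f g h i j \<longleftrightarrow>
     f i < f j \<and> g i < g j \<or> f i < f j \<and> h i < h j \<or> g i < g j \<and> h i < h j"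

text \<open>Three voters may be described by integer ranks on any index set \<open>A\<close> in bijection with \<open>X\<close>;
  smaller ranks are preferred.  This reduces the constructions below to arithmetic on indices.\<close>

lemma elects_majority3:
  assumes e: "bij_betw e X A"
    and inj: "inj_on f A" "inj_on g A" "inj_on h A"
  defines "score \<equiv> \<lambda>i. card {j \<in> A. majority3 f g h i j}"
  shows "elects X 3 {x \<in> X. \<forall>j \<in> A. score j \<le> score (e x)}"
proof -
  have eX: "e ` X = A" and inj_e: "inj_on e X" using e by (auto simp: bij_betw_def)
  define R where "R = (\<lambda>k :: _ \<Rightarrow> int. {(x, y). x \<in> X \<and> y \<in> X \<and> k (e x) < k (e y)})"
  define u where "u = restrict (\<lambda>i. R (if i = 1 then f else if i = 2 then g else h)) {1..3::nat}"
  have R: "R k \<in> strong_orderings X" if "inj_on k A" for k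
    using strong_orderings_key[of "k \<circ> e" X] comp_inj_on[OF inj_e, of k] that eX
    by (simp add: R_def)
  have u: "u \<in> profiles X 3"
    using inj by (intro profilesI) (auto simp: u_def R)
  have count: "(\<Sum>i=1..3. of_bool ((x, y) \<in> u i)) =
      of_bool (f (e x) < f (e y)) + of_bool (g (e x) < g (e y)) + (of_bool (h (e x) < h (e y)) :: nat)"
    if "x \<in> X" "y \<in> X" for x y
    using that by (simp add: u_def R_def numeral_3_eq_3)
  have "defeats 3 u x y \<longleftrightarrow> majority3 f g h (e x) (e y)" if "x \<in> X" "y \<in> X" for x y
  proof (cases "x = y")
    case True
    then show ?thesis by (simp add: defeats_def majority3_def)
  next
    case False
    then have exy: "e x \<in> A" "e y \<in> A" "e x \<noteq> e y"
      using inj_on_eq_iff[OF inj_e] that eX by auto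
    then have "f (e x) \<noteq> f (e y)" "g (e x) \<noteq> g (e y)" "h (e x) \<noteq> h (e y)"
      using inj_on_eq_iff[OF inj(1)] inj_on_eq_iff[OF inj(2)] inj_on_eq_iff[OF inj(3)] exy
      by simp_all
    then have flip: "f (e y) < f (e x) \<longleftrightarrow> \<not> f (e x) < f (e y)"
        "g (e y) < g (e x) \<longleftrightarrow> \<not> g (e x) < g (e y)"
        "h (e y) < h (e x) \<longleftrightarrow> \<not> h (e x) < h (e y)"
      by linarith+
    show ?thesis
      unfolding defeats_iff_sum count[OF that] count[OF that(2,1)] majority3_def flip
      by (cases "f (e x) < f (e y)"; cases "g (e x) < g (e y)"; cases "h (e x) < h (e y)") simp_all
  qed
  then have "{y \<in> X. defeats 3 u x y} = {y \<in> X. majority3 f g h (e x) (e y)}" if "x \<in> X" for x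
    using that by auto
  moreover have "card {y \<in> X. majority3 f g h i (e y)} = card {j \<in> A. majority3 f g h i j}" for i
    using inj_e eX by (intro bij_betw_same_card[of e]) (auto simp: bij_betw_def inj_on_def)
  ultimately have "copeland_score X 3 u x = score (e x)" if "x \<in> X" for x
    using that by (simp add: copeland_score_def score_def)
  then have "copeland_rule X 3 u = {x \<in> X. \<forall>j \<in> A. score j \<le> score (e x)}"
    using eX by (auto simp: copeland_rule_def)
  with u show ?thesis unfolding elects_def by blast
qed

text \<open>On \<open>{0..2q}\<close> the following three rankings are the residues of
  \<open>i\<close>, \<open>-2i - 2\<close> and \<open>i + q + 1\<close> modulo \<open>2q + 1\<close>.  The first ranks smaller numbers higher.  The
  other two agree in ranking \<open>j\<close> above some \<open>i < j\<close> exactly when \<open>j - i > q\<close>, so these are the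
  pairs on which they overrule the first.\<close>

definition rot1 :: "nat \<Rightarrow> int" where
  "rot1 i = int i"

definition rot2 :: "nat \<Rightarrow> nat \<Rightarrow> int" where
  "rot2 q i = (if i < q then 2 * int q - 1 else 4 * int q) - 2 * int i"

definition rot3 :: "nat \<Rightarrow> nat \<Rightarrow> int" where
  "rot3 q i = (if i < q then int i + int q + 1 else int i - int q)"

lemma rot_inj: "inj_on rot1 A" "inj_on (rot2 q) {..2 * q}" "inj_on (rot3 q) {..2 * q}"
proof -
  show "inj_on rot1 A" by (simp add: inj_on_def rot1_def)
  show "inj_on (rot2 q) {..2 * q}"
  proof (rule inj_onI)
    fix i j assume "rot2 q i = rot2 q j"
    then show "i = j" by (cases "i < q"; cases "j < q"; simp add: rot2_def; presburger)
  qed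
  show "inj_on (rot3 q) {..2 * q}"
  proof (rule inj_onI)
    fix i j assume "i \<in> {..2 * q}" "j \<in> {..2 * q}" "rot3 q i = rot3 q j"
    then show "i = j" by (cases "i < q"; cases "j < q"; simp add: rot3_def)
  qed
qed

lemma majority3_rot:
  assumes "i \<le> 2 * q" "j \<le> 2 * q"
  shows "majority3 rot1 (rot2 q) (rot3 q) i j \<longleftrightarrow> i < j \<and> j \<le> i + q \<or> j + q < i"
proof -
  have "rot1 i < rot1 j \<longleftrightarrow> i < j" by (simp add: rot1_def)
  moreover have "rot2 q i < rot2 q j \<longleftrightarrow>
      (if i < q \<longleftrightarrow> j < q then j < i else if i < q then j \<le> i + q else j + q < i)"
    by (cases "i < q"; cases "j < q"; simp add: rot2_def; arith)
  moreover have "rot3 q i < rot3 q j \<longleftrightarrow> (if i < q \<longleftrightarrow> j < q then i < j else q \<le> i)"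
    using assms by (cases "i < q"; cases "j < q"; simp add: rot3_def; linarith)
  ultimately show ?thesis
    using assms unfolding majority3_def by (cases "i < q"; cases "j < q"; simp; arith)
qed

lemma card_rot:
  assumes "i \<le> 2 * q"
  shows "card {j. j \<le> 2 * q \<and> (i < j \<and> j \<le> i + q \<or> j + q < i)} = q"
proof (cases "i \<le> q")
  case True
  then have "{j. j \<le> 2 * q \<and> (i < j \<and> j \<le> i + q \<or> j + q < i)} = {i<..i + q}" by auto
  then show ?thesis by simp
next
  case False
  then have "{j. j \<le> 2 * q \<and> (i < j \<and> j \<le> i + q \<or> j + q < i)} = {i<..2 * q} \<union> {..<i - q}"
    using assms by auto
  moreover have "{i<..2 * q} \<inter> {..<i - q} = {}" by auto
  ultimately show ?thesis using assms False by (simp add: card_Un_disjoint)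
qed

text \<open>All scores in the rotational tournament are equal.\<close>

lemma elects_three_all:
  assumes "finite X" "card X = 2 * q + 1"
  shows "elects X 3 X"
proof -
  have "card X = card {..2 * q}" using assms by simp
  with assms obtain e where e: "bij_betw e X {..2 * q}"
    using finite_same_card_bij by blast
  have "card {j \<in> {..2 * q}. majority3 rot1 (rot2 q) (rot3 q) i j} = q" if "i \<le> 2 * q" for i
  proof -
    have "{j \<in> {..2 * q}. majority3 rot1 (rot2 q) (rot3 q) i j} =
        {j. j \<le> 2 * q \<and> (i < j \<and> j \<le> i + q \<or> j + q < i)}"
      using majority3_rot that by auto
    then show ?thesis using card_rot[OF that] by simp
  qed
  moreover have "e x \<le> 2 * q" if "x \<in> X" for x using bij_betwE[OF e] that by auto
  ultimately show ?thesis
    using elects_majority3[OF e rot_inj] by (simp cong: conj_cong)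
qed

lemma maximal_iff_attains_bound:
  fixes T :: "'b \<Rightarrow> nat"
  assumes "\<And>j. j \<in> A \<Longrightarrow> T j \<le> s" "z \<in> A" "T z = s" "i \<in> A"
  shows "(\<forall>j\<in>A. T j \<le> T i) \<longleftrightarrow> T i = s"
proof
  assume "\<forall>j\<in>A. T j \<le> T i"
  then show "T i = s" using assms by (auto intro: le_antisym)
qed (use assms in simp)

text \<open>The rotational tournament is laid on \<open>S\<close> and \<open>a\<close>, with \<open>a\<close> in the role of \<open>2q\<close>, and the
  extra index \<open>2q + 1\<close> stands for \<open>b\<close>.  In the first ranking \<open>2q\<close> comes last, and \<open>b\<close> is put
  immediately before it; in the second \<open>b\<close> is put at the top and in the third at the bottom.
  Hence the first and third voters prefer every member of \<open>S\<close> to \<open>b\<close>, and the first and second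
  prefer \<open>b\<close> to \<open>a\<close>.\<close>

lemma elects_three_all_but_two:
  assumes "finite S" "card S = 2 * q" "q \<ge> 1" "a \<notin> S" "b \<notin> S" "a \<noteq> b"
  shows "elects (insert a (insert b S)) 3 S"
proof -
  \<comment> \<open>The first ranking is doubled to make room for \<open>b\<close> between \<open>2q - 1\<close> and \<open>2q\<close>.\<close>
  define f where "f = (\<lambda>i. if i = Suc (2 * q) then 4 * int q - 1 else 2 * rot1 i)"
  define g where "g = (\<lambda>i. if i = Suc (2 * q) then - 1 else rot2 q i)"
  define h where "h = (\<lambda>i. if i = Suc (2 * q) then 2 * int q + 1 else rot3 q i)"
  let ?A = "{..Suc (2 * q)}"
  let ?score = "\<lambda>i. card {j \<in> ?A. majority3 f g h i j}"
  have A: "?A = insert (Suc (2 * q)) {..2 * q}" by auto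
  have inj_new: "inj_on (\<lambda>i. if i = Suc (2 * q) then c else k i) ?A"
    if "inj_on k {..2 * q}" "\<And>i. i \<le> 2 * q \<Longrightarrow> k i \<noteq> c" for k :: "nat \<Rightarrow> int" and c
  proof (rule inj_onI)
    fix i j assume ij: "i \<in> ?A" "j \<in> ?A"
      "(if i = Suc (2 * q) then c else k i) = (if j = Suc (2 * q) then c else k j)"
    then show "i = j"
      using inj_onD[OF that(1), of i j] that(2)[of i] that(2)[of j] unfolding A
      by (cases "i = Suc (2 * q)"; cases "j = Suc (2 * q)") simp_all
  qed
  have "inj_on f ?A" unfolding f_def
  proof (rule inj_new)
    show "inj_on (\<lambda>i. 2 * rot1 i) {..2 * q}" by (simp add: inj_on_def rot1_def)
    show "2 * rot1 i \<noteq> 4 * int q - 1" for i unfolding rot1_def by presburger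
  qed
  moreover have "inj_on g ?A" unfolding g_def
    by (rule inj_new[OF rot_inj(2)]) (simp add: rot2_def)
  moreover have "inj_on h ?A" unfolding h_def
    by (rule inj_new[OF rot_inj(3)]) (simp add: rot3_def)
  ultimately have inj: "inj_on f ?A" "inj_on g ?A" "inj_on h ?A" by blast+
  have core: "majority3 f g h i j \<longleftrightarrow> i < j \<and> j \<le> i + q \<or> j + q < i"
    if "i \<le> 2 * q" "j \<le> 2 * q" for i j
    using majority3_rot[OF that] that by (auto simp: majority3_def f_def g_def h_def)
  have to_b: "majority3 f g h i (Suc (2 * q)) \<longleftrightarrow> i < 2 * q" if "i \<le> 2 * q" for i
    using that unfolding majority3_def f_def g_def h_def rot1_def rot2_def rot3_def
    by (cases "i < q"; simp; linarith)
  have from_b: "majority3 f g h (Suc (2 * q)) j \<longleftrightarrow> j = 2 * q" if "j \<le> Suc (2 * q)" for j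
    using that unfolding majority3_def f_def g_def h_def rot1_def rot2_def rot3_def
    by (cases "j < q"; simp; linarith)
  have score: "?score i = (if i < 2 * q then Suc q else q)" if "i \<le> 2 * q" for i
  proof -
    let ?C = "{j. j \<le> 2 * q \<and> (i < j \<and> j \<le> i + q \<or> j + q < i)}"
    have "{j \<in> ?A. majority3 f g h i j} = (if i < 2 * q then insert (Suc (2 * q)) ?C else ?C)"
      unfolding A using core[OF that] to_b[OF that] by auto
    then show ?thesis using card_rot[OF that] by (simp add: finite_subset[of ?C "{..2 * q}"])
  qed
  have "{j \<in> ?A. majority3 f g h (Suc (2 * q)) j} = {2 * q}"
    using from_b by auto
  then have score_b: "?score (Suc (2 * q)) = 1" by simp
  have "card S = card {..<2 * q}" using assms by simp
  with assms(1) obtain e0 where e0: "bij_betw e0 S {..<2 * q}"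
    using finite_same_card_bij by blast
  define e where "e = e0(a := 2 * q, b := Suc (2 * q))"
  have eS: "e x < 2 * q" if "x \<in> S" for x
    using bij_betwE[OF e0] that assms(4,5) by (auto simp: e_def)
  have eab: "e a = 2 * q" "e b = Suc (2 * q)" using assms(6) by (auto simp: e_def)
  have "bij_betw e S {..<2 * q}"
    using e0 assms(4,5) by (subst bij_betw_cong[of _ _ e0]) (auto simp: e_def)
  then have "bij_betw e (insert a (insert b S)) (insert (2 * q) (insert (Suc (2 * q)) {..<2 * q}))"
    using eab assms(4-6) by (auto simp: bij_betw_def)
  moreover have "insert (2 * q) (insert (Suc (2 * q)) {..<2 * q}) = ?A" by auto
  ultimately have e: "bij_betw e (insert a (insert b S)) ?A" by simp
  have le: "?score i \<le> Suc q" if "i \<in> ?A" for i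
    using that score[of i] score_b assms(3) unfolding A by (cases "i = Suc (2 * q)") auto
  have "?score 0 = Suc q" "0 \<in> ?A" using score[of 0] assms(3) by simp_all
  then have "(\<forall>j\<in>?A. ?score j \<le> ?score i) \<longleftrightarrow> ?score i = Suc q" if "i \<in> ?A" for i
    using le that by (intro maximal_iff_attains_bound[of ?A ?score "Suc q" 0])
  then have "{x \<in> insert a (insert b S). \<forall>j\<in>?A. ?score j \<le> ?score (e x)} =
      {x \<in> insert a (insert b S). ?score (e x) = Suc q}"
    using bij_betwE[OF e] by blast
  also have "\<dots> = S"
  proof -
    have "?score (e x) = Suc q" if "x \<in> S" for x
      using score[of "e x"] eS[OF that] by simp
    moreover have "?score (e a) \<noteq> Suc q" using score[of "2 * q"] eab by simp
    moreover have "?score (e b) \<noteq> Suc q" using score_b eab assms(3) by simp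
    ultimately show ?thesis by blast
  qed
  finally show ?thesis using elects_majority3[OF e inj] by simp
qed

section \<open>Obstructions for odd electorates\<close>

lemma defeats_total:
  assumes "u \<in> profiles X n" "odd n" "x \<in> X" "y \<in> X" "x \<noteq> y"
  shows "defeats n u x y \<longleftrightarrow> \<not> defeats n u y x"
proof -
  have "of_bool ((x, y) \<in> u i) + of_bool ((y, x) \<in> u i) = (1::nat)" if "i \<in> {1..n}" for i
    using profilesD[OF assms(1) that] assms(3-5)
    by (auto simp: strong_orderings_def total_on_def asym_iff)
  then have "(\<Sum>i=1..n. of_bool ((x, y) \<in> u i) + of_bool ((y, x) \<in> u i)) = (\<Sum>i=1..n. 1::nat)"
    by (rule sum.cong[OF refl])
  then have "(\<Sum>i=1..n. of_bool ((x, y) \<in> u i)) + (\<Sum>i=1..n. of_bool ((y, x) \<in> u i)) = n"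
    unfolding sum.distrib by simp
  then show ?thesis using \<open>odd n\<close> unfolding defeats_iff_sum by presburger
qed

text \<open>Each of the \<open>m (m - 1) / 2\<close> pairs of alternatives contributes one to exactly one score.
  Summing over ordered pairs instead counts everything twice.\<close>

lemma sum_copeland_scores:
  assumes "finite X" "u \<in> profiles X n" "odd n"
  shows "2 * (\<Sum>x\<in>X. copeland_score X n u x) = card X * (card X - 1)"
proof -
  let ?d = "\<lambda>x y. of_bool (defeats n u x y) :: nat"
  have "(\<Sum>x\<in>X. copeland_score X n u x) = (\<Sum>x\<in>X. \<Sum>y\<in>X. ?d x y)"
    using \<open>finite X\<close> by (simp add: copeland_score_def of_bool_def sum.If_cases Int_def conj_commute)
  then have "2 * (\<Sum>x\<in>X. copeland_score X n u x) = (\<Sum>x\<in>X. \<Sum>y\<in>X. ?d x y) + (\<Sum>x\<in>X. \<Sum>y\<in>X. ?d y x)"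
    using sum.swap[of ?d X X] by simp
  also have "\<dots> = (\<Sum>x\<in>X. \<Sum>y\<in>X. ?d x y + ?d y x)" by (simp add: sum.distrib)
  also have "\<dots> = (\<Sum>x\<in>X. card X - 1)"
  proof (rule sum.cong)
    fix x assume x: "x \<in> X"
    have "?d x y + ?d y x = of_bool (y \<noteq> x)" if "y \<in> X" for y
      using defeats_total[OF assms(2,3) x that] by (auto simp: defeats_def)
    then have "(\<Sum>y\<in>X. ?d x y + ?d y x) = (\<Sum>y\<in>X. of_bool (y \<noteq> x))" by simp
    also have "\<dots> = card (X - {x})"
      using \<open>finite X\<close> by (simp add: of_bool_def sum.If_cases Int_def set_diff_eq)
    finally show "(\<Sum>y\<in>X. ?d x y + ?d y x) = card X - 1" using x by simp
  qed simp
  finally show ?thesis by simp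
qed

text \<open>The average score \<open>(m - 1) / 2\<close> would have to be an integer.\<close>

lemma not_elects_all:
  assumes "finite X" "even (card X)" "X \<noteq> {}" "odd n"
  shows "\<not> elects X n X"
proof
  assume "elects X n X"
  then obtain u where u: "u \<in> profiles X n" "copeland_rule X n u = X"
    unfolding elects_def by blast
  obtain z where z: "z \<in> X" using assms(3) by blast
  let ?s = "copeland_score X n u"
  have "?s x = ?s z" if "x \<in> X" for x
  proof -
    have "\<And>x w. x \<in> X \<Longrightarrow> w \<in> X \<Longrightarrow> ?s w \<le> ?s x"
      using u(2) unfolding copeland_rule_def by blast
    then show ?thesis using z that by (simp add: le_antisym)
  qed
  then have "2 * (card X * ?s z) = card X * (card X - 1)"
    using sum_copeland_scores[OF assms(1) u(1) assms(4)] by simp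
  then have "2 * ?s z = card X - 1" using assms(1,3) by auto
  moreover have "card X > 0" using assms(1,3) by (simp add: card_gt_0_iff)
  ultimately show False using assms(2) by presburger
qed

text \<open>The average score is the integer \<open>p\<close> with \<open>m = 2p + 1\<close>.  With all but one score equal to
  \<open>s\<close>, any excess of \<open>s\<close> over \<open>p\<close> has to be offset \<open>2p\<close>-fold by the remaining score, which
  can fall short of \<open>p\<close> by at most \<open>p\<close>; and \<open>s \<le> p\<close> would push the remaining score up to at
  least \<open>p\<close>, so that it would be maximal too.\<close>

lemma not_elects_all_but_one:
  assumes "finite X" "odd (card X)" "y \<in> X" "X \<noteq> {y}" "odd n"
  shows "\<not> elects X n (X - {y})"
proof
  assume "elects X n (X - {y})"
  then obtain u where u: "u \<in> profiles X n" "copeland_rule X n u = X - {y}"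
    unfolding elects_def by blast
  obtain z where z: "z \<in> X - {y}" using assms(3,4) by blast
  let ?s = "copeland_score X n u"
  have max: "?s w \<le> ?s x" if "x \<in> X - {y}" "w \<in> X" for x w
    using u(2) that unfolding copeland_rule_def by blast
  then have eq: "?s x = ?s z" if "x \<in> X - {y}" for x
    using z that by (simp add: le_antisym)
  have "?s y < ?s z"
  proof (rule ccontr)
    assume "\<not> ?s y < ?s z"
    with max z have "\<forall>w\<in>X. ?s w \<le> ?s y" by (meson not_less order_trans)
    with \<open>y \<in> X\<close> u(2) show False unfolding copeland_rule_def by blast
  qed
  moreover have "2 * (?s y + (card X - 1) * ?s z) = card X * (card X - 1)"
    using sum_copeland_scores[OF assms(1) u(1) assms(5)] eq assms(1,3)
    by (simp add: sum.remove)
  moreover obtain p where p: "card X = 2 * p + 1" using assms(2) by (elim oddE)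
  ultimately have *: "?s y < ?s z" "?s y + 2 * p * ?s z = (2 * p + 1) * p" by auto
  show False
  proof (cases "?s z \<le> p")
    case True
    then have "2 * p * ?s z \<le> 2 * p * p" by simp
    moreover have "?s y + 2 * p * ?s z = 2 * p * p + p" using * by (simp add: algebra_simps)
    ultimately have "p \<le> ?s y" by linarith
    with * True show False by simp
  next
    case False
    then have "2 * p * Suc p \<le> 2 * p * ?s z" by (intro mult_le_mono) auto
    with * have "p = 0" by (simp add: algebra_simps)
    with * p assms show False
      by (metis One_nat_def add.left_neutral card_1_singletonE mult_0_right singletonD)
  qed
qed

theorem mainTheorem6:
  fixes X S :: "'a set" and m n k :: nat
  assumes "finite X" and "card X = m" and "m \<ge> 3" and "n \<ge> 2"
    and "S \<subseteq> X" and "card S = k" and "1 \<le> k" and "k \<le> m"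
  shows "(even n \<longrightarrow> (\<exists>u \<in> profiles X n. copeland_rule X n u = S)) \<and>
         (odd n \<and> even m \<longrightarrow> ((\<exists>u \<in> profiles X n. copeland_rule X n u = S) \<longleftrightarrow> k \<noteq> m)) \<and>
         (odd n \<and> odd m \<longrightarrow> ((\<exists>u \<in> profiles X n. copeland_rule X n u = S) \<longleftrightarrow> k \<noteq> m - 1))"
proof -
  have S: "finite S" "S \<noteq> {}" using assms finite_subset by auto
  have even: "elects X n S" if "even n"
  proof -
    have "elects X 2 S"
      using elects_superset[OF elects_two_all[OF S(1)] \<open>S \<subseteq> X\<close> \<open>finite X\<close> S(2)] by simp
    then have "elects X (2 + 2 * ((n - 2) div 2)) S" by (intro elects_add_voter_pairs) auto
    moreover have "2 + 2 * ((n - 2) div 2) = n" using that \<open>n \<ge> 2\<close> by simp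
    ultimately show ?thesis by simp
  qed
  have odd: "elects X n S" if "odd n" "odd k \<or> k + 2 \<le> m"
  proof -
    \<comment> \<open>For even \<open>k\<close> the premise leaves two alternatives outside \<open>S\<close>.\<close>
    have "elects X 3 S"
    proof (cases "odd k")
      case True
      then obtain q where "k = 2 * q + 1" by (elim oddE)
      then have "elects S 3 S" using elects_three_all S(1) assms(6) by blast
      then show ?thesis using elects_superset S(2) assms(1,5) by (metis numeral_le_iff one_le_numeral)
    next
      case False
      then obtain q where q: "k = 2 * q" by blast
      have "2 \<le> card (X - S)"
        using that False assms S(1) by (simp add: card_Diff_subset)
      then obtain a b where ab: "a \<in> X - S" "b \<in> X - S" "a \<noteq> b"
        using card_le_Suc0_iff_eq[of "X - S"] assms(1) by auto
      then have "elects (insert a (insert b S)) 3 S"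
        using q assms(6,7) S(1) by (intro elects_three_all_but_two[of S q]) auto
      then show ?thesis using ab assms(1,5) by (elim elects_superset) auto
    qed
    then have "elects X (3 + 2 * ((n - 3) div 2)) S" by (intro elects_add_voter_pairs) auto
    moreover have "3 + 2 * ((n - 3) div 2) = n" using that \<open>n \<ge> 2\<close> by presburger
    ultimately show ?thesis by simp
  qed
  have all: "\<not> elects X n S" if "odd n" "even m" "k = m"
  proof -
    have "S = X" using that assms(1,2,5,6) by (simp add: card_subset_eq)
    then show ?thesis using not_elects_all[of X n] that assms S by simp
  qed
  have but_one: "\<not> elects X n S" if "odd n" "odd m" "k = m - 1"
  proof -
    have "card (X - S) = 1" using that assms S(1) by (simp add: card_Diff_subset)
    then obtain y where y: "X - S = {y}" by (rule card_1_singletonE)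
    then have "S = X - {y}" "y \<in> X" "X \<noteq> {y}" using assms(5) S(2) by auto
    then show ?thesis using not_elects_all_but_one[of X y n] that assms(1,2) by simp
  qed
  have "odd k \<or> k + 2 \<le> m" if "odd n" "even m" "k \<noteq> m"
    using that \<open>k \<le> m\<close> by presburger
  moreover have "odd k \<or> k + 2 \<le> m" if "odd n" "odd m" "k \<noteq> m - 1"
    using that \<open>k \<le> m\<close> by presburger
  ultimately show ?thesis
    using even odd all but_one unfolding elects_def by blast
qed

end
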